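(* Let $\eta_j\colon\mathbb C\setminus[0,+\infty)\to\mathbb C\setminus[0,+\infty)$, $j\in\{1,2\}$, be two analytic functions satisfying the conditions (a) $\lim_{x\to0,\,x<0}\eta_j(x)=0$, $j\in\{1,2\}$; (b) $\pi>\arg\eta_j(z)>\arg z$ for $z\in\mathbb C^+$, $j\in\{1,2\}$; (c) $\eta_j(\overline z)=\overline{\eta_j(z)}$ for $z\in\mathbb C\setminus[0,+\infty)$, $j\in\{1,2\}$. Define $h_j\colon\mathbb C\setminus[0,+\infty)\to\mathbb C$ by $h_j(z)=\frac{\eta_j(z)}z$, and let $f\colon(\mathbb C^+\cup\mathbb R\setminus\{0\})\times\mathbb C^+\to\mathbb C$ be given by $$f(z,w)=h_2\big(z\,h_1(zw)\big).$$ Then: (1) The function $f$ is well-defined and takes values in $\mathbb C^+$. (2) There exists a unique analytic function $h\colon\mathbb C^+\to\mathbb C^+$ such that $f(z,h(z))=h(z)$ for all $z\in\mathbb C^+$.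
   Context: $\mathbb C^+=\{z\in\mathbb C:\Im z>0\}$. The argument on $\mathbb C\setminus[0,+\infty)$ takes values in $(0,2\pi)$, so that it lies in $(0,\pi)$ on $\mathbb C^+$ and equals $\pi$ on $(-\infty,0)$. *)

theory Defs
  imports "HOL-Complex_Analysis.Complex_Analysis" "HOL-Library.FuncSet"
begin

definition upper_half :: "complex set" where
  "upper_half = {z. Im z > 0}"

definition slit_plane :: "complex set" where
  "slit_plane = UNIV - \<real>\<^sub>\<ge>\<^sub>0"

text \<open>
  The argument with values in \<open>(0, 2 * pi)\<close> on the slit plane is the library function
  \<^const>\<open>Arg2pi\<close>. Below, only the values \<open>eta j\<close> for \<open>j \<in> {1, 2}\<close> on the slit plane are
  meaningful.
\<close>

definition eta_quot :: "(nat \<Rightarrow> complex \<Rightarrow> complex) \<Rightarrow> nat \<Rightarrow> complex \<Rightarrow> complex" where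
  "eta_quot eta j z = eta j z / z"

definition sub_domain :: "(complex \<times> complex) set" where
  "sub_domain = (upper_half \<union> (\<real> - {0})) \<times> upper_half"

definition sub_fun ::
    "(nat \<Rightarrow> complex \<Rightarrow> complex) \<Rightarrow> complex \<Rightarrow> complex \<Rightarrow> complex" where
  "sub_fun eta z w = eta_quot eta 2 (z * eta_quot eta 1 (z * w))"

text \<open>
  Functions are total in HOL, so that the formula for \<^const>\<open>sub_fun\<close> makes sense at \<open>(z, w)\<close>
  means that each \<^term>\<open>eta_quot eta j\<close> is applied to a point of its domain, the slit plane.
\<close>

definition sub_fun_defined_at ::
    "(nat \<Rightarrow> complex \<Rightarrow> complex) \<Rightarrow> complex \<Rightarrow> complex \<Rightarrow> bool" where
  "sub_fun_defined_at eta z w \<longleftrightarrow>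
     z * w \<in> slit_plane \<and> z * eta_quot eta 1 (z * w) \<in> slit_plane"

end

theory Submission
  imports Defs
begin

text \<open>
  Multiplying out arguments shows that \<open>f(z, \<cdot>)\<close> maps \<open>\<complex>\<^sup>+\<close> to itself, is still analytic with values in
  \<open>\<complex>\<^sup>+\<close> near the positive axis, and preserves the sector \<open>0 \<le> arg w \<le> \<pi> - arg z\<close>.

  Existence of a fixed point: each \<open>h\<^sub>j\<close> is positive and increasing on the negative axis, \<open>\<eta>\<^sub>j\<close> is
  increasing there, and a Harnack inequality transports the resulting bounds to sectors. Together
  with \<open>\<eta>\<^sub>j(0-) = 0\<close> they give \<open>\<bar>f(z, w)\<bar> \<ge> \<bar>w\<bar>\<close> near \<open>0\<close> and \<open>\<bar>f(z, w)\<bar> \<le> \<bar>w\<bar>\<close> near \<open>\<infinity>\<close> in the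
  sector, so that a truncated sector is preserved and Brouwer's theorem applies. This replaces the
  Denjoy-Wolff theorem.

  Uniqueness: by the Schwarz lemma, a second fixed point or a derivative of modulus \<open>1\<close> at the fixed
  point would make \<open>f(z, \<cdot>)\<close> conjugate to a rotation of the disc, which maps boundary points to
  boundary points, whereas \<open>f(z, 1) \<in> \<complex>\<^sup>+\<close>. Since the derivative is not \<open>1\<close>, the fixed point depends
  analytically on \<open>z\<close>.
\<close>

subsection \<open>Fixed points of self-maps of the upper half-plane\<close>

text \<open>The difference of the squared moduli of \<open>w - cnj w0\<close> and
  \<open>w - w0\<close> is \<open>4 * Im w0 * Im w\<close>.\<close>

lemma norm_cayley_less_1_iff:
  assumes "Im w0 > 0" "w \<noteq> cnj w0"
  shows "cmod ((w - w0) / (w - cnj w0)) < 1 \<longleftrightarrow> Im w > 0"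
proof -
  have "cmod ((w - w0) / (w - cnj w0)) < 1 \<longleftrightarrow> cmod (w - w0) < cmod (w - cnj w0)"
    using assms by (simp add: norm_divide divide_simps)
  also have "\<dots> \<longleftrightarrow> (cmod (w - w0))\<^sup>2 < (cmod (w - cnj w0))\<^sup>2"
    by (simp add: abs_square_less_1 power2_less_imp_less power_strict_mono linorder_not_le[symmetric])
  also have "\<dots> \<longleftrightarrow> 0 < Im w0 * Im w"
    by (simp only: cmod_power2) (simp add: power2_eq_square algebra_simps)
  finally show ?thesis
    using assms by (simp add: zero_less_mult_iff)
qed

text \<open>Conjugation by the Cayley transform \<open>c\<close> centred at \<open>w0\<close> gives
  a self-map \<open>G\<close> of the disc fixing 0, to which the Schwarz lemma applies. The boundary
  point \<open>x\<close> with interior image rules out the equality case.\<close>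

lemma upper_half_self_map_fixed_point:
  fixes \<phi> :: "complex \<Rightarrow> complex" and x :: real
  assumes hol: "\<phi> holomorphic_on upper_half"
    and maps: "\<phi> \<in> upper_half \<rightarrow> upper_half"
    and w0: "w0 \<in> upper_half" "\<phi> w0 = w0"
    and cont: "continuous_on (insert (of_real x) upper_half) \<phi>"
    and bdry: "\<phi> (of_real x) \<in> upper_half"
  shows norm_deriv_less_1: "cmod (deriv \<phi> w0) < 1"
    and fixed_point_unique: "\<And>w. w \<in> upper_half \<Longrightarrow> \<phi> w = w \<Longrightarrow> w = w0"
proof -
  define c where "c w = (w - w0) / (w - cnj w0)" for w
  \<comment> \<open>The inverse of \<open>c\<close>; its pole 1 is the image of infinity under
    \<open>c\<close>.\<close>
  define d where "d \<zeta> = (w0 - cnj w0 * \<zeta>) / (1 - \<zeta>)" for \<zeta>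
  define G where "G = (\<lambda>\<zeta>. c (\<phi> (d \<zeta>)))"
  have y0: "Im w0 > 0" and w0_neq: "w0 \<noteq> cnj w0"
    using w0 by (auto simp: upper_half_def complex_eq_iff)
  have neq: "w \<noteq> cnj w0" if "Im w \<ge> 0" for w
    using that y0 by auto
  have cd: "c (d \<zeta>) = \<zeta>" "d \<zeta> \<noteq> cnj w0" if "\<zeta> \<noteq> 1" for \<zeta>
  proof -
    have 1: "d \<zeta> - cnj w0 = (w0 - cnj w0) / (1 - \<zeta>)" and 2: "d \<zeta> - w0 = (w0 - cnj w0) * \<zeta> / (1 - \<zeta>)"
      using that by (simp_all add: d_def divide_simps algebra_simps)
    show "c (d \<zeta>) = \<zeta>"
      unfolding c_def 1 2 using that w0_neq by (simp add: divide_simps)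
    show "d \<zeta> \<noteq> cnj w0"
      using 1 that w0_neq by auto
  qed
  have dc: "d (c w) = w" if "w \<noteq> cnj w0" for w
  proof -
    have 1: "w0 - cnj w0 * c w = w * (w0 - cnj w0) / (w - cnj w0)"
      and 2: "1 - c w = (w0 - cnj w0) / (w - cnj w0)"
      using that by (simp_all add: c_def divide_simps algebra_simps)
    show ?thesis
      unfolding d_def 1 2 using that w0_neq by (simp add: divide_simps)
  qed
  have norm_c: "cmod (c w) < 1 \<longleftrightarrow> Im w > 0" if "w \<noteq> cnj w0" for w
    using norm_cayley_less_1_iff[OF y0 that] by (simp add: c_def)
  have d_in: "d \<zeta> \<in> upper_half" if "cmod \<zeta> < 1" for \<zeta>
  proof -
    have "\<zeta> \<noteq> 1" using that by auto
    then show ?thesis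
      using cd[of \<zeta>] norm_c[of "d \<zeta>"] that by (simp add: upper_half_def)
  qed
  have d_der: "(d has_field_derivative (w0 - cnj w0)) (at 0)"
    unfolding d_def by (auto intro!: derivative_eq_intros)
  have c_der: "(c has_field_derivative 1 / (w0 - cnj w0)) (at w0)"
    unfolding c_def using w0_neq by (auto intro!: derivative_eq_intros simp: divide_simps)
  have d_hol: "d holomorphic_on ball 0 1"
    unfolding d_def by (intro holomorphic_intros) auto
  have c_hol: "c holomorphic_on upper_half"
    unfolding c_def using neq by (intro holomorphic_intros) (auto simp: upper_half_def)
  have d0: "d 0 = w0" and c0: "c w0 = 0"
    by (simp_all add: d_def c_def)
  have G_hol: "G holomorphic_on ball 0 1"
    unfolding G_def
    using maps d_in
    by (intro holomorphic_on_compose_gen[OF holomorphic_on_compose_gen[OF d_hol hol] c_hol, unfolded o_def])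
       (auto simp: Pi_iff)
  have G0: "G 0 = 0"
    by (simp add: G_def d0 w0 c0)
  have G_lt: "cmod (G \<zeta>) < 1" if "cmod \<zeta> < 1" for \<zeta>
    using maps d_in[OF that] norm_c[of "\<phi> (d \<zeta>)"] neq[of "\<phi> (d \<zeta>)"]
    by (auto simp: G_def upper_half_def Pi_iff)
  have not_rotation: "\<not> (\<exists>\<alpha>. (\<forall>\<zeta>. cmod \<zeta> < 1 \<longrightarrow> G \<zeta> = \<alpha> * \<zeta>) \<and> cmod \<alpha> = 1)"
  proof
    assume "\<exists>\<alpha>. (\<forall>\<zeta>. cmod \<zeta> < 1 \<longrightarrow> G \<zeta> = \<alpha> * \<zeta>) \<and> cmod \<alpha> = 1"
    then have rot: "cmod (G \<zeta>) = cmod \<zeta>" if "cmod \<zeta> < 1" for \<zeta>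
      using that by (auto simp: norm_mult)
    have eq: "cmod (c (\<phi> w)) = cmod (c w)" if "w \<in> upper_half" for w
    proof -
      have "w \<noteq> cnj w0" using that neq[of w] by (auto simp: upper_half_def)
      then show ?thesis
        using rot[of "c w"] norm_c[of w] dc[of w] that by (simp add: G_def upper_half_def)
    qed
    \<comment> \<open>If \<open>G\<close> were a rotation, \<open>c\<close> would have the same
      modulus at \<open>w\<close> and at \<open>\<phi> w\<close>. Letting \<open>w\<close> descend
      vertically to \<open>x\<close> carries this to the boundary, where \<open>c\<close> does not
      have modulus below 1.\<close>
    let ?s = "\<lambda>n. Complex x (inverse (of_nat (Suc n)))"
    have s: "?s \<longlonglongrightarrow> of_real x"
      using tendsto_Complex[OF tendsto_const LIMSEQ_inverse_real_of_nat, of x]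
      by (simp add: complex_of_real_def)
    have s_in: "?s n \<in> upper_half" for n
      by (simp add: upper_half_def)
    have "(\<lambda>n. \<phi> (?s n)) \<longlonglongrightarrow> \<phi> (of_real x)"
      using cont s s_in by (auto simp: continuous_on_sequentially o_def)
    then have "(\<lambda>n. cmod (c (\<phi> (?s n)))) \<longlonglongrightarrow> cmod (c (\<phi> (of_real x)))"
      unfolding c_def using bdry neq by (intro tendsto_intros) (auto simp: upper_half_def)
    moreover have "(\<lambda>n. cmod (c (?s n))) \<longlonglongrightarrow> cmod (c (of_real x))"
      unfolding c_def using s neq[of "of_real x"] by (intro tendsto_intros) auto
    ultimately have "cmod (c (\<phi> (of_real x))) = cmod (c (of_real x))"
      using eq s_in LIMSEQ_unique by (simp add: eq s_in)
    moreover have "cmod (c (\<phi> (of_real x))) < 1"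
      using bdry norm_c[of "\<phi> (of_real x)"] neq[of "\<phi> (of_real x)"] by (simp add: upper_half_def)
    ultimately show False
      using norm_c[of "of_real x"] neq[of "of_real x"] by simp
  qed
  show "w = w0" if "w \<in> upper_half" "\<phi> w = w" for w
  proof (rule ccontr)
    assume "w \<noteq> w0"
    have w: "w \<noteq> cnj w0" "Im w > 0" using that neq[of w] by (auto simp: upper_half_def)
    have "cmod (c w) < 1" "c w \<noteq> 0" "G (c w) = c w"
      using w norm_c[of w] \<open>w \<noteq> w0\<close> dc[of w] that by (auto simp: G_def c_def)
    then show False
      using Schwarz_Lemma(3)[OF G_hol G0 G_lt, of 0] not_rotation by (metis norm_zero zero_less_one)
  qed
  \<comment> \<open>The derivatives of \<open>c\<close> at \<open>w0\<close> and \<open>d\<close> at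
    0 are reciprocal, so \<open>G\<close> and \<open>\<phi>\<close> have the same multiplier at
    their fixed points.\<close>
  have "(\<phi> has_field_derivative deriv \<phi> w0) (at w0)"
    using hol w0 by (intro holomorphic_derivI[of _ upper_half])
      (auto simp: upper_half_def open_halfspace_Im_gt)
  then have "((\<lambda>\<zeta>. \<phi> (d \<zeta>)) has_field_derivative deriv \<phi> w0 * (w0 - cnj w0)) (at 0)"
    using d_der by (intro DERIV_chain2[of \<phi>]) (simp_all add: d0)
  then have "(G has_field_derivative 1 / (w0 - cnj w0) * (deriv \<phi> w0 * (w0 - cnj w0))) (at 0)"
    unfolding G_def using c_der by (intro DERIV_chain2[of c]) (simp_all add: d0 w0)
  then have "deriv G 0 = deriv \<phi> w0"
    using w0_neq by (simp add: DERIV_imp_deriv)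
  moreover have "cmod (deriv G 0) \<le> 1" "cmod (deriv G 0) \<noteq> 1"
    using Schwarz_Lemma(2,3)[OF G_hol G0 G_lt, of 0] not_rotation by auto
  ultimately show "cmod (deriv \<phi> w0) < 1" by simp
qed

text \<open>A pointwise implicit function theorem: \<open>F\<close> is differentiable at one point
  only, and continuity of \<open>g\<close> is not assumed but follows from uniqueness. The formula
  comes from differentiating \<open>F (z, g z) = g z\<close>.\<close>

lemma implicit_fixed_point_derivative:
  fixes F :: "complex \<times> complex \<Rightarrow> complex"
  assumes der: "(F has_derivative (\<lambda>p. A * fst p + B * snd p)) (at (z0, w0))"
    and B: "cmod B < 1" and fix0: "F (z0, w0) = w0"
    and U: "open U" "z0 \<in> U" and V: "open V" "w0 \<in> V"
    and cont: "\<And>z. z \<in> U \<Longrightarrow> continuous_on V (\<lambda>w. F (z, w))"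
    and uniq: "\<And>z w. z \<in> U \<Longrightarrow> w \<in> V \<Longrightarrow> F (z, w) = w \<Longrightarrow> w = g z"
  shows "(g has_field_derivative A / (1 - B)) (at z0)"
proof -
  \<comment> \<open>\<open>k\<close> is a remainder constant leaving the contraction factor
    \<open>cmod B + k = 1 - k\<close> below 1; \<open>C\<close> solves
    \<open>cmod A + k + (1 - k) * C = C\<close>.\<close>
  define k where "k = (1 - cmod B) / 2"
  define C where "C = (cmod A + k) / k"
  have k: "k > 0" "cmod B + k = 1 - k" using B by (simp_all add: k_def field_simps)
  have C: "C \<ge> 1" using k by (simp add: C_def)
  have g0: "g z0 = w0" using uniq[of z0 w0] U V fix0 by simp
  have remainder: "\<exists>\<delta>>0. \<forall>z w. dist z z0 < \<delta> \<longrightarrow> dist w w0 < \<delta> \<longrightarrow>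
      cmod (F (z, w) - w0 - (A * (z - z0) + B * (w - w0))) \<le> e * (cmod (z - z0) + cmod (w - w0))"
    if "e > 0" for e
  proof -
    obtain d where d: "d > 0" and
      dd: "\<And>p. norm (p - (z0, w0)) < d \<Longrightarrow>
        norm (F p - F (z0, w0) - (A * fst (p - (z0, w0)) + B * snd (p - (z0, w0)))) \<le> e * norm (p - (z0, w0))"
      using der \<open>e > 0\<close> unfolding has_derivative_at_alt by meson
    show ?thesis
    proof (intro exI[of _ "d / 2"] conjI allI impI)
      fix z w assume zw: "dist z z0 < d / 2" "dist w w0 < d / 2"
      have n: "norm ((z, w) - (z0, w0)) \<le> cmod (z - z0) + cmod (w - w0)"
        using norm_Pair_le[of "z - z0" "w - w0"] by simp
      also have "\<dots> < d" using zw by (simp add: dist_norm)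
      finally have "cmod (F (z, w) - w0 - (A * (z - z0) + B * (w - w0))) \<le> e * norm ((z, w) - (z0, w0))"
        using dd[of "(z, w)"] fix0 by simp
      also have "\<dots> \<le> e * (cmod (z - z0) + cmod (w - w0))"
        using n \<open>e > 0\<close> by (intro mult_left_mono) auto
      finally show "cmod (F (z, w) - w0 - (A * (z - z0) + B * (w - w0))) \<le> e * (cmod (z - z0) + cmod (w - w0))" .
    qed (use d in auto)
  qed
  obtain \<delta>1 where \<delta>1: "\<delta>1 > 0" and r1: "\<And>z w. dist z z0 < \<delta>1 \<Longrightarrow> dist w w0 < \<delta>1 \<Longrightarrow>
      cmod (F (z, w) - w0 - (A * (z - z0) + B * (w - w0))) \<le> k * (cmod (z - z0) + cmod (w - w0))"
    using remainder[OF k(1)] by meson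
  obtain \<delta>2 where \<delta>2: "\<delta>2 > 0" "ball z0 \<delta>2 \<subseteq> U"
    using U by (meson open_contains_ball)
  obtain \<delta>3 where \<delta>3: "\<delta>3 > 0" "ball w0 \<delta>3 \<subseteq> V"
    using V by (meson open_contains_ball)
  \<comment> \<open>Within this radius the ball of radius \<open>C * cmod (z - z0)\<close> about
    \<open>w0\<close> lies in \<open>V\<close> and in the range of the remainder estimate for
    \<open>k\<close>.\<close>
  define \<delta> where "\<delta> = Min {\<delta>1 / C, \<delta>2, \<delta>3 / C}"
  have \<delta>: "\<delta> > 0" "\<delta> \<le> \<delta>2" "C * \<delta> \<le> \<delta>1" "C * \<delta> \<le> \<delta>3" "\<delta> \<le> \<delta>1"
  proof -
    show "\<delta> > 0" using \<delta>1 \<delta>2 \<delta>3 C by (simp add: \<delta>_def)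
    show "\<delta> \<le> \<delta>2" by (simp add: \<delta>_def)
    have "\<delta> \<le> \<delta>1 / C" "\<delta> \<le> \<delta>3 / C" by (simp_all add: \<delta>_def)
    then show *: "C * \<delta> \<le> \<delta>1" "C * \<delta> \<le> \<delta>3" using C by (simp_all add: field_simps)
    have "1 * \<delta> \<le> C * \<delta>" using C \<open>\<delta> > 0\<close> by (intro mult_right_mono) auto
    then show "\<delta> \<le> \<delta>1" using * by simp
  qed
  \<comment> \<open>For \<open>z\<close> near \<open>z0\<close>, the map \<open>F (z, \<cdot>)\<close> preserves the ball of radius \<open>C \<bar>z - z0\<bar>\<close> about \<open>w0\<close>;
    by Brouwer it has a fixed point there, which must be \<open>g z\<close>.\<close>
  have lip: "cmod (g z - w0) \<le> C * cmod (z - z0)" "F (z, g z) = g z" if z: "dist z z0 < \<delta>" for z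
  proof -
    let ?\<epsilon> = "C * cmod (z - z0)"
    have zU: "z \<in> U" using z \<delta> \<delta>2 by (auto simp: dist_commute)
    have e: "?\<epsilon> < C * \<delta>" using z C by (simp add: dist_norm)
    have sub: "cball w0 ?\<epsilon> \<subseteq> V"
      using e \<delta> \<delta>3 by (force simp: subset_iff)
    have "F (z, w) \<in> cball w0 ?\<epsilon>" if w: "w \<in> cball w0 ?\<epsilon>" for w
    proof -
      have "dist w w0 < \<delta>1" using w e \<delta> by (simp add: dist_commute)
      then have r: "cmod (F (z, w) - w0 - (A * (z - z0) + B * (w - w0))) \<le> k * (cmod (z - z0) + cmod (w - w0))"
        using z \<delta> by (intro r1) auto
      have wn: "cmod (w - w0) \<le> ?\<epsilon>" using w by (simp add: dist_norm norm_minus_commute)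
      have "cmod (F (z, w) - w0) \<le> cmod (F (z, w) - w0 - (A * (z - z0) + B * (w - w0)))
          + (cmod (A * (z - z0)) + cmod (B * (w - w0)))"
        using norm_triangle_ineq[of "F (z, w) - w0 - (A * (z - z0) + B * (w - w0))" "A * (z - z0) + B * (w - w0)"]
          norm_triangle_ineq[of "A * (z - z0)" "B * (w - w0)"] by simp
      also have "\<dots> \<le> k * (cmod (z - z0) + cmod (w - w0)) + (cmod (A * (z - z0)) + cmod (B * (w - w0)))"
        using r by simp
      also have "\<dots> = (cmod A + k) * cmod (z - z0) + (cmod B + k) * cmod (w - w0)"
        by (simp add: norm_mult distrib_left distrib_right)
      also have "\<dots> \<le> (cmod A + k) * cmod (z - z0) + (cmod B + k) * ?\<epsilon>"
        using wn k by (intro add_mono mult_left_mono) auto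
      also have "\<dots> = (cmod A + k) * cmod (z - z0) + (1 - k) * ?\<epsilon>"
        by (simp only: k(2))
      also have "\<dots> = ?\<epsilon>"
        using k by (simp add: C_def field_simps)
      finally show ?thesis by (simp add: dist_norm norm_minus_commute)
    qed
    then obtain w where w: "w \<in> cball w0 ?\<epsilon>" "F (z, w) = w"
      using brouwer[of "cball w0 ?\<epsilon>" "\<lambda>w. F (z, w)"] continuous_on_subset[OF cont[OF zU] sub] C
      by (auto simp: Pi_iff not_less)
    then have "w = g z" using uniq zU sub by blast
    then show "cmod (g z - w0) \<le> ?\<epsilon>" "F (z, g z) = g z"
      using w by (auto simp: dist_norm norm_minus_commute)
  qed
  have B1: "1 - B \<noteq> 0" using B by auto
  show ?thesis
    unfolding has_field_derivative_def has_derivative_at_alt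
  proof (intro conjI allI impI)
    show "bounded_linear ((*) (A / (1 - B)))" by (rule bounded_linear_mult_right)
    fix e :: real assume "e > 0"
    \<comment> \<open>Chosen so that the Lipschitz bound \<open>lip\<close> and the final division
      by \<open>1 - B\<close> leave exactly \<open>e\<close>.\<close>
    define e' where "e' = e * cmod (1 - B) / (1 + C)"
    have "e' > 0" using \<open>e > 0\<close> B1 C by (simp add: e'_def)
    obtain d where d: "d > 0" and r: "\<And>z w. dist z z0 < d \<Longrightarrow> dist w w0 < d \<Longrightarrow>
      cmod (F (z, w) - w0 - (A * (z - z0) + B * (w - w0))) \<le> e' * (cmod (z - z0) + cmod (w - w0))"
      using remainder[OF \<open>e' > 0\<close>] by meson
    show "\<exists>d>0. \<forall>y. norm (y - z0) < d \<longrightarrow>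
        norm (g y - g z0 - A / (1 - B) * (y - z0)) \<le> e * norm (y - z0)"
    proof (intro exI[of _ "min \<delta> (d / C)"] conjI allI impI)
      fix z assume "norm (z - z0) < min \<delta> (d / C)"
      then have z: "dist z z0 < \<delta>" "C * cmod (z - z0) < d"
        using C by (auto simp: dist_norm field_simps)
      have "1 * cmod (z - z0) \<le> C * cmod (z - z0)" using C by (intro mult_right_mono) auto
      then have "dist z z0 < d" "dist (g z) w0 < d"
        using z lip(1)[OF z(1)] by (auto simp: dist_norm)
      then have "cmod (F (z, g z) - w0 - (A * (z - z0) + B * (g z - w0))) \<le> e' * (cmod (z - z0) + cmod (g z - w0))"
        by (rule r)
      also have "\<dots> \<le> e' * ((1 + C) * cmod (z - z0))"
        using lip(1)[OF z(1)] \<open>e' > 0\<close> by (intro mult_left_mono) (auto simp: algebra_simps)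
      also have "\<dots> = e * cmod (z - z0) * cmod (1 - B)"
        using C by (simp add: e'_def)
      also have "F (z, g z) - w0 - (A * (z - z0) + B * (g z - w0)) = (g z - w0 - A / (1 - B) * (z - z0)) * (1 - B)"
        unfolding lip(2)[OF z(1)] using B1 by (simp add: divide_simps algebra_simps)
      finally show "norm (g z - g z0 - A / (1 - B) * (z - z0)) \<le> e * norm (z - z0)"
        using B1 by (simp add: norm_mult g0)
    qed (use \<delta> d C in auto)
  qed
qed

subsection \<open>A single map of the slit plane\<close>

text \<open>\<open>Im F\<close> vanishes on the axis and is nonnegative above it, so its vertical
  derivative there is nonnegative. By the Cauchy-Riemann equations this is the derivative of
  \<open>Re F\<close> along the axis.\<close>

lemma mono_on_negative_axis:
  assumes hol: "F holomorphic_on slit_plane"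
    and pos: "\<And>z. z \<in> upper_half \<Longrightarrow> Im (F z) \<ge> 0"
    and real: "\<And>x. x < 0 \<Longrightarrow> F (of_real x) \<in> \<real>"
    and ab: "a \<le> b" "b < 0"
  shows "Re (F (of_real a)) \<le> Re (F (of_real b))"
proof (rule DERIV_nonneg_imp_nondecreasing[OF ab(1)])
  fix x assume "a \<le> x" "x \<le> b"
  then have x: "x < 0" using ab by simp
  have op: "open slit_plane"
    by (simp add: slit_plane_def open_Diff)
  have "of_real x \<in> slit_plane"
    using x by (simp add: slit_plane_def)
  then have D: "(F has_field_derivative deriv F (of_real x)) (at (of_real x))"
    using hol op by (intro holomorphic_derivI)
  let ?v = "\<lambda>y. Im (F (of_real x + \<i> * of_real y))"
  have "((\<lambda>y. F (of_real x + \<i> * of_real y)) has_vector_derivative \<i> * deriv F (of_real x)) (at 0)"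
    by (rule field_vector_diff_chain_at[of "\<lambda>y. of_real x + \<i> * of_real y", unfolded o_def])
       (use D in \<open>auto intro!: derivative_eq_intros simp: has_vector_derivative_def scaleR_conv_of_real\<close>)
  then have v: "(?v has_field_derivative Re (deriv F (of_real x))) (at 0)"
    using has_field_derivative_Im by fastforce
  have "Re (deriv F (of_real x)) \<ge> 0"
  proof (rule ccontr)
    assume "\<not> ?thesis"
    then obtain d where "d > 0" "\<forall>h>0. h < d \<longrightarrow> ?v (0 + h) < ?v 0"
      using DERIV_neg_dec_right[OF v] by auto
    then have "?v (d / 2) < ?v 0" by (metis add_0 field_sum_of_halves half_gt_zero less_add_same_cancel1)
    moreover have "?v 0 = 0" using real[OF x] by (simp add: complex_is_Real_iff)
    moreover have "?v (d / 2) \<ge> 0" using \<open>d > 0\<close> by (intro pos) (simp add: upper_half_def)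
    ultimately show False by simp
  qed
  moreover have "((\<lambda>x. Re (F (of_real x))) has_field_derivative Re (deriv F (of_real x))) (at x)"
  proof -
    have "((\<lambda>x. F (of_real x)) has_vector_derivative deriv F (of_real x)) (at x)"
      using field_vector_diff_chain_at[of of_real 1 x F, unfolded o_def] D
      by (auto intro!: derivative_eq_intros simp: has_vector_derivative_def scaleR_conv_of_real)
    then show ?thesis using has_field_derivative_Re by fastforce
  qed
  ultimately show "\<exists>y. ((\<lambda>x. Re (F (of_real x))) has_field_derivative y) (at x) \<and> y \<ge> 0"
    by blast
qed

section \<open>Polar coordinates on the slit plane and the upper half-plane\<close>

lemma open_slit_plane: "open slit_plane"
  by (simp add: slit_plane_def open_Diff)

lemma open_upper_half: "open upper_half"
  by (simp add: upper_half_def open_halfspace_Im_gt)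

lemma upper_halfD:
  assumes "z \<in> upper_half"
  shows "Im z \<ge> 0" "z \<noteq> 0"
  using assms by (auto simp: upper_half_def)

lemma rcis_in_slit_plane:
  assumes "r > 0" "0 < a" "a < 2 * pi"
  shows "rcis r a \<in> slit_plane"
proof -
  consider "a < pi" | "a = pi" | "a > pi" by linarith
  then show ?thesis
  proof cases
    case 1
    then have "sin a > 0" using assms by (simp add: sin_gt_zero)
    then show ?thesis using assms by (auto simp: slit_plane_def complex_nonneg_Reals_iff)
  next
    case 2
    then show ?thesis using assms by (auto simp: slit_plane_def complex_nonneg_Reals_iff)
  next
    case 3
    then have "sin a < 0" using assms by (simp add: sin_lt_zero)
    then show ?thesis using assms by (auto simp: slit_plane_def complex_nonneg_Reals_iff)
  qed
qed

lemma rcis_in_upper_half: "r > 0 \<Longrightarrow> 0 < a \<Longrightarrow> a < pi \<Longrightarrow> rcis r a \<in> upper_half"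
  by (simp add: upper_half_def sin_gt_zero)

lemma rcis_cmod_Arg2pi: "rcis (cmod z) (Arg2pi z) = z"
  using Arg2pi_eq[of z] by (simp add: rcis_def cis_conv_exp)

lemma Arg2pi_rcis: "r > 0 \<Longrightarrow> 0 \<le> a \<Longrightarrow> a < 2 * pi \<Longrightarrow> Arg2pi (rcis r a) = a"
  by (rule Arg2pi_unique[of r]) (simp_all add: rcis_def cis_conv_exp)

lemma closed_upper_half_polar:
  assumes "Im z \<ge> 0" "z \<noteq> 0"
  obtains r a where "z = rcis r a" "r > 0" "0 \<le> a" "a \<le> pi"
  using assms that[of "cmod z" "Arg2pi z"] Arg2pi_le_pi[of z] Arg2pi_ge_0[of z]
  by (simp add: rcis_cmod_Arg2pi)

lemma upper_half_polar:
  assumes "z \<in> upper_half"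
  obtains r a where "z = rcis r a" "r > 0" "0 < a" "a < pi"
proof
  show "z = rcis (cmod z) (Arg2pi z)" by (simp add: rcis_cmod_Arg2pi)
  show "cmod z > 0" using assms by (auto simp: upper_half_def)
  show "Arg2pi z > 0" "Arg2pi z < pi" using assms Arg2pi_lt_pi[of z] by (auto simp: upper_half_def)
qed

text \<open>The hypotheses on one map, so that all estimates for its quotient are proved once and
  used for both.\<close>

locale slit_map =
  fixes \<eta> :: "complex \<Rightarrow> complex"
  assumes maps: "\<eta> \<in> slit_plane \<rightarrow> slit_plane"
    and hol: "\<eta> holomorphic_on slit_plane"
    and lim: "((\<lambda>x::real. \<eta> (of_real x)) \<longlongrightarrow> 0) (at_left 0)"
    and arg: "z \<in> upper_half \<Longrightarrow> Arg2pi z < Arg2pi (\<eta> z) \<and> Arg2pi (\<eta> z) < pi"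
    and sym: "z \<in> slit_plane \<Longrightarrow> \<eta> (cnj z) = cnj (\<eta> z)"
begin

definition quot :: "complex \<Rightarrow> complex" where
  "quot z = \<eta> z / z"

text \<open>The angle of the quotient is the difference of the two arguments. Writing it as a
  fraction \<open>l\<close> of \<open>pi - a\<close> gives a form that survives reflection, where
  \<open>pi - a\<close> changes sign.\<close>

lemma quot_polar_upper:
  assumes "r > 0" "0 < a" "a < pi"
  shows "\<exists>p l. p > 0 \<and> 0 < l \<and> l < 1 \<and> quot (rcis r a) = rcis p (l * (pi - a))"
proof -
  let ?z = "rcis r a" and ?b = "Arg2pi (\<eta> (rcis r a))"
  have b: "a < ?b" "?b < pi"
    using arg[OF rcis_in_upper_half[OF assms]] Arg2pi_rcis[of r a] assms by auto
  have "\<eta> ?z \<in> slit_plane"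
    using maps rcis_in_slit_plane[of r a] assms by auto
  then have n: "cmod (\<eta> ?z) > 0" by (auto simp: slit_plane_def)
  have "quot ?z = rcis (cmod (\<eta> ?z) / r) (?b - a)"
    unfolding quot_def by (subst rcis_cmod_Arg2pi[of "\<eta> ?z", symmetric]) (rule rcis_divide)
  moreover have "?b - a = (?b - a) / (pi - a) * (pi - a)" using assms by simp
  ultimately show ?thesis
    using b n assms by (intro exI[of _ "cmod (\<eta> ?z) / r"] exI[of _ "(?b - a) / (pi - a)"]) auto
qed

text \<open>The condition on arguments on both half-planes and on the negative axis at once: the
  argument of \<open>quot z\<close> lies strictly between \<open>0\<close> and \<open>\<pi> - arg z\<close>, unless both vanish.\<close>

lemma quot_polar:
  assumes "r > 0" "0 < a" "a < 2 * pi"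
  shows "\<exists>p l. p > 0 \<and> 0 < l \<and> l < 1 \<and> quot (rcis r a) = rcis p (l * (pi - a))"
proof -
  consider "a < pi" | "a = pi" | "a > pi" by linarith
  then show ?thesis
  proof cases
    case 1
    then show ?thesis using quot_polar_upper assms by blast
  next
    case 2
    \<comment> \<open>By symmetry the value of \<open>\<eta>\<close> is real, hence negative, and
      the quotient is positive. As \<open>pi - a = 0\<close>, any \<open>l\<close> works; 1/2 is
      taken.\<close>
    have z: "rcis r a = - of_real r" "rcis r a \<in> slit_plane"
      using 2 assms rcis_in_slit_plane[of r a] by (auto simp: complex_eq_iff)
    then have "cnj (\<eta> (rcis r a)) = \<eta> (rcis r a)"
      using sym[OF z(2)] by simp
    then have "Im (\<eta> (rcis r a)) = 0" by (metis Reals_cnj_iff complex_is_Real_iff)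
    moreover have "\<eta> (rcis r a) \<in> slit_plane" using maps z by auto
    ultimately have "Re (\<eta> (rcis r a)) < 0" "\<eta> (rcis r a) = of_real (Re (\<eta> (rcis r a)))"
      by (auto simp: slit_plane_def complex_nonneg_Reals_iff complex_eq_iff)
    then have "quot (rcis r a) = rcis (- Re (\<eta> (rcis r a)) / r) (1 / 2 * (pi - a))"
      "- Re (\<eta> (rcis r a)) / r > 0"
      using 2 z assms by (auto simp: quot_def divide_neg_pos)
    then show ?thesis
      by (intro exI[of _ "- Re (\<eta> (rcis r a)) / r"] exI[of _ "1/2"]) auto
  next
    case 3
    have z: "rcis r a = cnj (rcis r (2 * pi - a))"
      by (simp add: complex_eq_iff)
    obtain p l where pl: "p > 0" "0 < l" "l < 1"
      "quot (rcis r (2 * pi - a)) = rcis p (l * (pi - (2 * pi - a)))"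
      using quot_polar_upper[of r "2 * pi - a"] 3 assms by auto
    have "quot (rcis r a) = cnj (quot (rcis r (2 * pi - a)))"
      unfolding z quot_def using sym[OF rcis_in_slit_plane[of r "2 * pi - a"]] 3 assms by simp
    also have "\<dots> = rcis p (- (l * (pi - (2 * pi - a))))"
      unfolding pl(4) by (simp add: complex_eq_iff)
    also have "- (l * (pi - (2 * pi - a))) = l * (pi - a)" by (simp add: algebra_simps)
    finally show ?thesis using pl by blast
  qed
qed

section \<open>Analyticity of the quotient and its growth on the negative axis\<close>

lemma quot_hol: "quot holomorphic_on slit_plane"
  unfolding quot_def by (intro holomorphic_intros hol) (auto simp: slit_plane_def)

text \<open>By \<open>quot_neg\<close> this is the value of \<open>quot\<close> at \<open>-r\<close>
  itself; the modulus only serves to make it a real number.\<close>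

definition H :: "real \<Rightarrow> real" where
  "H r = cmod (quot (- of_real r))"

lemma quot_neg: "r > 0 \<Longrightarrow> quot (- of_real r) = of_real (H r)"
  and H_pos: "r > 0 \<Longrightarrow> H r > 0"
proof -
  assume r: "r > 0"
  have "rcis r pi = - of_real r" by (simp add: complex_eq_iff)
  then obtain p where "p > 0" "quot (- of_real r) = of_real p"
    using quot_polar[of r pi] r by auto
  then show "quot (- of_real r) = of_real (H r)" "H r > 0" by (auto simp: H_def)
qed

lemma eta_neg: "r > 0 \<Longrightarrow> \<eta> (- of_real r) = of_real (- (r * H r))"
  using quot_neg[of r] by (simp add: quot_def field_simps) (metis minus_equation_iff)

lemma quot_upper: "z \<in> upper_half \<Longrightarrow> quot z \<in> upper_half"
proof -
  assume "z \<in> upper_half"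
  then obtain r a where z: "z = rcis r a" "r > 0" "0 < a" "a < pi" by (rule upper_half_polar)
  then obtain p l where pl: "p > 0" "0 < l" "l < 1" "quot z = rcis p (l * (pi - a))"
    using quot_polar[of r a] by auto
  have "l * (pi - a) < 1 * (pi - a)" using pl z by (intro mult_strict_right_mono) auto
  moreover have "l * (pi - a) > 0" using pl z by simp
  moreover have "1 * (pi - a) < pi" using z by simp
  ultimately show ?thesis
    unfolding pl(4) using pl(1) by (intro rcis_in_upper_half) linarith+
qed

text \<open>\<open>quot\<close> preserves the upper half-plane, so it increases along the negative
  axis; passing to the distance \<open>r\<close> from 0 reverses the order.\<close>

lemma H_antimono:
  assumes "0 < r" "r \<le> s"
  shows "H s \<le> H r"
proof -
  have "Re (quot (of_real (- s))) \<le> Re (quot (of_real (- r)))"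
  proof (rule mono_on_negative_axis[OF quot_hol])
    show "Im (quot z) \<ge> 0" if "z \<in> upper_half" for z
      using quot_upper[OF that] by (simp add: upper_half_def)
    show "quot (of_real x) \<in> \<real>" if "x < 0" for x
      using quot_neg[of "- x"] that by simp
  qed (use assms in auto)
  then show ?thesis using quot_neg[of r] quot_neg[of s] assms by simp
qed

text \<open>The same monotonicity applied to \<open>\<eta>\<close>, whose value at \<open>-r\<close>
  is \<open>-(r * H r)\<close>. So \<open>H\<close> decreases no faster than
  \<open>1 / r\<close>.\<close>

lemma eta_neg_mono:
  assumes "0 < r" "r \<le> s"
  shows "r * H r \<le> s * H s"
proof -
  have "Re (\<eta> (of_real (- s))) \<le> Re (\<eta> (of_real (- r)))"
  proof (rule mono_on_negative_axis[OF hol])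
    show "Im (\<eta> z) \<ge> 0" if "z \<in> upper_half" for z
      using arg[OF that] Arg2pi_le_pi[of "\<eta> z"] by simp
    show "\<eta> (of_real x) \<in> \<real>" if "x < 0" for x
      using eta_neg[of "- x"] that by simp
  qed (use assms in auto)
  then show ?thesis using eta_neg[of r] eta_neg[of s] assms by simp
qed

text \<open>The limit condition at 0 enters the proof through this bound.\<close>

lemma eta_neg_small:
  assumes "e > 0"
  obtains d where "d > 0" "\<And>r. 0 < r \<Longrightarrow> r \<le> d \<Longrightarrow> r * H r \<le> e"
proof -
  have "eventually (\<lambda>x::real. cmod (\<eta> (of_real x)) < e) (at_left 0)"
    using lim assms by (simp add: tendsto_iff dist_norm)
  then obtain b where b: "b < 0" "\<And>x. b < x \<Longrightarrow> x < 0 \<Longrightarrow> cmod (\<eta> (of_real x)) < e"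
    unfolding eventually_at_left_field by blast
  show thesis
  proof
    show "- b / 2 > 0" using b by simp
    fix r assume r: "0 < r" "r \<le> - b / 2"
    then have "cmod (\<eta> (of_real (- r))) < e" using b by (intro b(2)) auto
    then show "r * H r \<le> e"
      using eta_neg[OF r(1)] H_pos[OF r(1)] r by (simp add: norm_mult)
  qed
qed

text \<open>A Harnack inequality. In the coordinate \<open>z = - exp s\<close>, \<open>\<bar>Im s\<bar> < \<pi>\<close>, the function
  \<open>Ln (quot z)\<close> has bounded imaginary part; Cauchy's estimate for the bounded function
  \<open>exp (\<i> Ln (quot z))\<close> bounds its derivative.\<close>

lemma harnack:
  assumes \<alpha>: "0 < \<alpha>" "\<alpha> \<le> pi"
  obtains C where "C > 0"
    "\<And>r a. 0 < r \<Longrightarrow> \<alpha> \<le> a \<Longrightarrow> a \<le> pi \<Longrightarrow> H r \<le> C * cmod (quot (rcis r a))"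
    "\<And>r a. 0 < r \<Longrightarrow> \<alpha> \<le> a \<Longrightarrow> a \<le> pi \<Longrightarrow> cmod (quot (rcis r a)) \<le> C * H r"
proof -
  define strip where "strip = {s. \<bar>Im s\<bar> < pi}"
  define q where "q s = Ln (quot (- exp s))" for s
  \<comment> \<open>Cauchy's estimate on discs of radius \<open>\<alpha> / 2\<close> bounds the
    derivative of \<open>E\<close> by \<open>exp pi / (\<alpha> / 2)\<close>; dividing by
    \<open>cmod (E s) \<ge> exp (- pi)\<close> gives the last factor.\<close>
  define B where "B = exp pi / (\<alpha> / 2) * exp pi"
  have exp_rcis: "- exp s = rcis (exp (Re s)) (pi + Im s)" for s
    by (simp add: complex_eq_iff Re_exp Im_exp)
  have in_slit: "- exp s \<in> slit_plane" if "s \<in> strip" for s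
    using that unfolding exp_rcis strip_def by (intro rcis_in_slit_plane) auto
  \<comment> \<open>The angle of the quotient is \<open>- l * Im s\<close>, of modulus below
    \<open>pi\<close>, so the principal logarithm is analytic at its values.\<close>
  have quot_nonpos: "quot (- exp s) \<notin> \<real>\<^sub>\<le>\<^sub>0" if "s \<in> strip" for s
  proof -
    have bounds: "0 < pi + Im s" "pi + Im s < 2 * pi" using that by (auto simp: strip_def)
    obtain p l where pl: "p > 0" "0 < l" "l < 1" "quot (- exp s) = rcis p (l * (pi - (pi + Im s)))"
      using quot_polar[of "exp (Re s)" "pi + Im s"] exp_gt_zero bounds unfolding exp_rcis by blast
    have "\<bar>l * Im s\<bar> \<le> 1 * \<bar>Im s\<bar>"
      unfolding abs_mult using pl by (intro mult_right_mono) auto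
    then have "\<bar>l * Im s\<bar> < pi" using that by (auto simp: strip_def)
    moreover have "- rcis p (l * (pi - (pi + Im s))) = rcis p (pi - l * Im s)"
      by (simp add: complex_eq_iff)
    ultimately have "- rcis p (l * (pi - (pi + Im s))) \<in> slit_plane"
      using rcis_in_slit_plane[of p "pi - l * Im s"] pl(1) by auto
    then show ?thesis
      using pl(4) by (auto simp: slit_plane_def complex_nonneg_Reals_iff complex_nonpos_Reals_iff)
  qed
  have open_strip: "open strip"
  proof -
    have "strip = {s. Im s < pi} \<inter> {s. Im s > - pi}" by (auto simp: strip_def)
    then show ?thesis by (simp add: open_Int open_halfspace_Im_gt open_halfspace_Im_lt)
  qed
  have q_hol: "q holomorphic_on strip"
  proof -
    have "(\<lambda>s. quot (- exp s)) holomorphic_on strip"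
      using holomorphic_on_compose_gen[of "\<lambda>s. - exp s" strip quot slit_plane] quot_hol in_slit
      by (auto simp: o_def intro!: holomorphic_intros)
    then show ?thesis
      unfolding q_def using quot_nonpos by (intro holomorphic_intros) auto
  qed
  define E where "E s = exp (\<i> * q s)" for s
  have E_hol: "E holomorphic_on strip"
    unfolding E_def by (intro holomorphic_intros q_hol)
  have E_norm: "cmod (E s) \<le> exp pi" "cmod (E s) \<ge> exp (- pi)" if "s \<in> strip" for s
  proof -
    have "quot (- exp s) \<noteq> 0" using quot_nonpos[OF that] by auto
    then have "- pi < Im (q s)" "Im (q s) \<le> pi"
      using mpi_less_Im_Ln Im_Ln_le_pi by (auto simp: q_def)
    then show "cmod (E s) \<le> exp pi" "cmod (E s) \<ge> exp (- pi)"
      by (auto simp: E_def)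
  qed
  have q_deriv: "cmod (deriv q s) \<le> B" if s: "\<bar>Im s\<bar> \<le> pi - \<alpha>" for s
  proof -
    have sub: "cball s (\<alpha> / 2) \<subseteq> strip"
    proof
      fix t assume "t \<in> cball s (\<alpha> / 2)"
      then have "\<bar>Im (s - t)\<bar> \<le> \<alpha> / 2"
        using abs_Im_le_cmod[of "s - t"] by (simp add: dist_norm)
      then have "\<bar>Im t\<bar> < pi" using s \<alpha> unfolding minus_complex.sel by linarith
      then show "t \<in> strip" by (simp add: strip_def)
    qed
    have s_in: "s \<in> strip" using s \<alpha> by (auto simp: strip_def)
    have "cmod ((deriv ^^ 1) E s) \<le> fact 1 * exp pi / (\<alpha> / 2) ^ 1"
    proof (rule Cauchy_inequality)
      show "E holomorphic_on ball s (\<alpha> / 2)"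
        using E_hol sub ball_subset_cball by (meson holomorphic_on_subset order_trans)
      show "continuous_on (cball s (\<alpha> / 2)) E"
        using E_hol sub by (meson holomorphic_on_imp_continuous_on holomorphic_on_subset)
      show "cmod (E x) \<le> exp pi" if "cmod (s - x) = \<alpha> / 2" for x
        using that sub by (intro E_norm) (auto simp: dist_norm)
    qed (use \<alpha> in auto)
    then have 1: "cmod (deriv E s) \<le> exp pi / (\<alpha> / 2)" by simp
    have "(q has_field_derivative deriv q s) (at s)"
      using q_hol open_strip s_in by (rule holomorphic_derivI)
    then have "(E has_field_derivative E s * (\<i> * deriv q s)) (at s)"
      unfolding E_def by (auto intro!: derivative_eq_intros)
    then have "cmod (deriv E s) = cmod (E s) * cmod (deriv q s)"
      by (simp add: DERIV_imp_deriv norm_mult)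
    then have "exp (- pi) * cmod (deriv q s) \<le> exp pi / (\<alpha> / 2)"
      using 1 mult_right_mono[OF E_norm(2)[OF s_in], of "cmod (deriv q s)"] by simp
    then show ?thesis
      unfolding B_def by (simp add: exp_minus field_simps)
  qed
  define S where "S = {s. \<bar>Im s\<bar> \<le> pi - \<alpha>}"
  have convex_S: "convex S"
  proof -
    have "S = {s. Im s \<le> pi - \<alpha>} \<inter> {s. Im s \<ge> - (pi - \<alpha>)}" by (auto simp: S_def)
    then show ?thesis by (simp only: convex_Int convex_halfspace_Im_le convex_halfspace_Im_ge)
  qed
  have bound: "\<bar>ln (cmod (quot (rcis r a))) - ln (H r)\<bar> \<le> B * pi"
    if "r > 0" "\<alpha> \<le> a" "a \<le> pi" for r a
  proof -
    \<comment> \<open>Preimages of \<open>rcis r a\<close> and \<open>-r\<close> under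
      \<open>- exp\<close>; they differ by a vertical segment of length at most
      \<open>pi\<close>.\<close>
    let ?s = "Complex (ln r) (a - pi)" and ?t = "Complex (ln r) 0"
    have st: "?s \<in> S" "?t \<in> S" using that \<alpha> by (auto simp: S_def)
    have sub: "S \<subseteq> strip" using \<alpha> by (auto simp: S_def strip_def)
    have "cmod (q ?s - q ?t) \<le> B * cmod (?s - ?t)"
      using convex_S _ _ st
    proof (rule field_differentiable_bound)
      show "(q has_field_derivative deriv q s) (at s within S)" if "s \<in> S" for s
        using q_hol open_strip that sub by (meson DERIV_subset holomorphic_derivI subset_UNIV subsetD)
      show "cmod (deriv q s) \<le> B" if "s \<in> S" for s
        using that q_deriv by (simp add: S_def)
    qed
    also have "cmod (?s - ?t) = \<bar>a - pi\<bar>" by (simp add: cmod_def)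
    also have "B * \<bar>a - pi\<bar> \<le> B * pi"
      using that \<alpha> by (intro mult_left_mono) (auto simp: B_def)
    finally have "\<bar>Re (q ?s - q ?t)\<bar> \<le> B * pi"
      using abs_Re_le_cmod order_trans by blast
    moreover have "Re (q ?s) = ln (cmod (quot (rcis r a)))"
    proof -
      have "- exp ?s = rcis r a" using that by (simp add: exp_rcis)
      moreover have "quot (- exp ?s) \<noteq> 0"
        using quot_nonpos[of ?s] st(1) sub by auto
      ultimately show ?thesis by (simp add: q_def)
    qed
    moreover have "Re (q ?t) = ln (H r)"
    proof -
      have "- exp ?t = - of_real r" using that by (simp add: complex_eq_iff Re_exp Im_exp)
      moreover have "quot (- exp ?t) \<noteq> 0"
        using quot_nonpos[of ?t] st(2) sub by auto
      ultimately show ?thesis by (simp add: q_def H_def)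
    qed
    ultimately show ?thesis by simp
  qed
  show thesis
  proof
    show "exp (B * pi) > 0" by simp
    fix r a :: real assume ra: "0 < r" "\<alpha> \<le> a" "a \<le> pi"
    obtain p l where "p > 0" "quot (rcis r a) = rcis p (l * (pi - a))"
      using quot_polar[of r a] ra \<alpha> by auto
    then have n: "cmod (quot (rcis r a)) > 0" by simp
    have "ln (H r) \<le> B * pi + ln (cmod (quot (rcis r a)))"
      "ln (cmod (quot (rcis r a))) \<le> B * pi + ln (H r)"
      using bound[OF ra] by linarith+
    then have "exp (ln (H r)) \<le> exp (B * pi + ln (cmod (quot (rcis r a))))"
      "exp (ln (cmod (quot (rcis r a)))) \<le> exp (B * pi + ln (H r))" by simp_all
    then show "H r \<le> exp (B * pi) * cmod (quot (rcis r a))"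
      "cmod (quot (rcis r a)) \<le> exp (B * pi) * H r"
      using n H_pos[OF ra(1)] by (simp_all add: exp_add)
  qed
qed

end

subsection \<open>The composition\<close>

locale slit_map_pair = M1: slit_map \<eta>1 + M2: slit_map \<eta>2 for \<eta>1 \<eta>2
begin

definition inner_arg :: "complex \<Rightarrow> complex \<Rightarrow> complex" where
  "inner_arg z w = z * M1.quot (z * w)"

definition f :: "complex \<Rightarrow> complex \<Rightarrow> complex" where
  "f z w = M2.quot (inner_arg z w)"

text \<open>The angle \<open>c\<close> of \<open>inner_arg z w\<close> is a proper convex combination of \<open>a\<close> and \<open>\<pi> - b\<close>.\<close>

lemma f_polar:
  assumes "r > 0" "s > 0" "0 \<le> a" "a \<le> pi" "0 \<le> b" "b \<le> pi"
    and int: "0 < a \<and> a < pi \<or> 0 < b \<and> b < pi"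
  obtains p c q d where "rcis r a * rcis s b \<in> slit_plane"
    "p > 0" "0 < c" "c < pi" "min a (pi - b) \<le> c" "inner_arg (rcis r a) (rcis s b) = rcis p c"
    "q > 0" "0 < d" "d \<le> pi - c" "f (rcis r a) (rcis s b) = rcis q d"
proof -
  have ab: "0 < a + b" "a + b < 2 * pi" using assms by auto
  obtain p l where pl: "p > 0" "0 < l" "l < 1" "M1.quot (rcis (r * s) (a + b)) = rcis p (l * (pi - (a + b)))"
    using M1.quot_polar[of "r * s" "a + b"] assms ab by auto
  define c where "c = (1 - l) * a + l * (pi - b)"
  have inner_arg: "inner_arg (rcis r a) (rcis s b) = rcis (r * p) c"
    by (simp add: inner_arg_def rcis_mult pl c_def algebra_simps)
  have c: "0 < c" "c < pi" "min a (pi - b) \<le> c"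
  proof -
    have nn: "(1 - l) * a \<ge> 0" "l * (pi - b) \<ge> 0" "(1 - l) * (pi - a) \<ge> 0" "l * b \<ge> 0"
      using pl assms by auto
    have pos: "(1 - l) * a > 0 \<or> l * (pi - b) > 0" "(1 - l) * (pi - a) > 0 \<or> l * b > 0"
      using pl int by auto
    show "0 < c" unfolding c_def using nn pos by linarith
    \<comment> \<open>The upper bound mirrors the lower one: \<open>pi - c\<close> combines
      \<open>pi - a\<close> and \<open>b\<close> with the same weights.\<close>
    have "pi - c = (1 - l) * (pi - a) + l * b" by (simp add: c_def algebra_simps)
    then show "c < pi" using nn pos by linarith
    \<comment> \<open>When \<open>b \<le> pi - a\<close>, this gives \<open>a \<le> c\<close> and so
      \<open>d \<le> pi - a\<close>: the sector is preserved.\<close>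
    have "(1 - l) * min a (pi - b) + l * min a (pi - b) \<le> c"
      unfolding c_def using pl by (intro add_mono mult_left_mono) auto
    then show "min a (pi - b) \<le> c" by (simp add: algebra_simps)
  qed
  obtain q m where qm: "q > 0" "0 < m" "m < 1" "M2.quot (rcis (r * p) c) = rcis q (m * (pi - c))"
    using M2.quot_polar[of "r * p" c] assms pl c by auto
  have "m * (pi - c) \<le> 1 * (pi - c)" using qm c by (intro mult_right_mono) auto
  moreover have "m * (pi - c) > 0" using qm c by simp
  ultimately show thesis
    using that[of "r * p" c q "m * (pi - c)"] rcis_in_slit_plane[of "r * s" "a + b"] assms ab pl c qm inner_arg
    by (simp add: rcis_mult f_def)
qed

text \<open>Only one of the two points has to be interior. This covers real \<open>z\<close> in the
  domain of \<open>f\<close> as well as real \<open>w\<close> in the fixed point argument for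
  \<open>f z\<close>.\<close>

lemma f_upper:
  assumes "Im z \<ge> 0" "z \<noteq> 0" "Im w \<ge> 0" "w \<noteq> 0" "z \<in> upper_half \<or> w \<in> upper_half"
  shows "z * w \<in> slit_plane" "inner_arg z w \<in> upper_half" "f z w \<in> upper_half"
proof -
  obtain r a where z: "z = rcis r a" "r > 0" "0 \<le> a" "a \<le> pi"
    using assms by (elim closed_upper_half_polar)
  obtain s b where w: "w = rcis s b" "s > 0" "0 \<le> b" "b \<le> pi"
    using assms by (elim closed_upper_half_polar)
  have "0 < a \<and> a < pi \<or> 0 < b \<and> b < pi"
    using assms(5) z w by (auto simp: upper_half_def less_le)
  then obtain p c q d where *: "z * w \<in> slit_plane"
    "p > 0" "0 < c" "c < pi" "inner_arg z w = rcis p c" "q > 0" "0 < d" "d \<le> pi - c" "f z w = rcis q d"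
    unfolding z(1) w(1) using f_polar z w by metis
  then show "z * w \<in> slit_plane" "inner_arg z w \<in> upper_half" "f z w \<in> upper_half"
    by (auto intro: rcis_in_upper_half)
qed

section \<open>Analyticity of \<open>f\<close> in each variable and jointly\<close>

lemma inner_slit: "inner_arg z w \<in> upper_half \<Longrightarrow> inner_arg z w \<in> slit_plane"
  by (auto simp: slit_plane_def upper_half_def complex_nonneg_Reals_iff)

lemma f_hol:
  assumes "open S" "\<And>w. w \<in> S \<Longrightarrow> z * w \<in> slit_plane" "\<And>w. w \<in> S \<Longrightarrow> inner_arg z w \<in> upper_half"
  shows "f z holomorphic_on S"
proof -
  have "(\<lambda>w. M1.quot (z * w)) holomorphic_on S"
    using holomorphic_on_compose_gen[of "\<lambda>w. z * w" S M1.quot slit_plane] M1.quot_hol assms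
    by (auto simp: o_def intro!: holomorphic_intros)
  then have "inner_arg z holomorphic_on S"
    unfolding inner_arg_def[abs_def] by (intro holomorphic_intros)
  then have "(\<lambda>w. M2.quot (inner_arg z w)) holomorphic_on S"
    using holomorphic_on_compose_gen[of "inner_arg z" S M2.quot slit_plane] M2.quot_hol assms(3) inner_slit
    by (auto simp: o_def)
  then show ?thesis by (simp add: f_def[abs_def])
qed

text \<open>\<open>S\<close> may reach the real axis away from 0, as needed at the boundary point 1
  and on the closed sector for Brouwer's theorem.\<close>

lemma f_cont:
  assumes "z \<in> upper_half" "\<And>w. w \<in> S \<Longrightarrow> Im w \<ge> 0 \<and> w \<noteq> 0"
  shows "continuous_on S (f z)"
proof -
  have *: "z * w \<in> slit_plane" "inner_arg z w \<in> slit_plane" if "w \<in> S" for w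
    using f_upper[of z w] assms that inner_slit upper_halfD by auto
  have "continuous_on S (\<lambda>w. M1.quot (z * w))"
    using * by (intro continuous_on_compose2[OF holomorphic_on_imp_continuous_on[OF M1.quot_hol]] continuous_intros) auto
  then have "continuous_on S (inner_arg z)"
    unfolding inner_arg_def[abs_def] by (intro continuous_intros)
  then have "continuous_on S (\<lambda>w. M2.quot (inner_arg z w))"
    using * by (intro continuous_on_compose2[OF holomorphic_on_imp_continuous_on[OF M2.quot_hol]]) auto
  then show ?thesis by (simp add: f_def[abs_def])
qed

lemma f_total_derivative:
  assumes "z0 \<in> upper_half" "w0 \<in> upper_half"
  obtains A B where
    "((\<lambda>p. f (fst p) (snd p)) has_derivative (\<lambda>p. A * fst p + B * snd p)) (at (z0, w0))"
proof -
  have *: "z0 * w0 \<in> slit_plane" "inner_arg z0 w0 \<in> slit_plane"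
    using f_upper[of z0 w0] assms inner_slit upper_halfD by auto
  define D1 where "D1 = deriv M1.quot (z0 * w0)"
  define D2 where "D2 = deriv M2.quot (inner_arg z0 w0)"
  have 1: "(M1.quot has_derivative (*) D1) (at (z0 * w0))"
    and 2: "(M2.quot has_derivative (*) D2) (at (inner_arg z0 w0))"
    using holomorphic_derivI[OF M1.quot_hol open_slit_plane *(1)]
      holomorphic_derivI[OF M2.quot_hol open_slit_plane *(2)]
    by (simp_all add: has_field_derivative_def D1_def D2_def)
  have "((\<lambda>p. fst p * snd p) has_derivative (\<lambda>p. z0 * snd p + fst p * w0)) (at (z0, w0))"
    by (auto intro!: derivative_eq_intros)
  then have "((\<lambda>p. M1.quot (fst p * snd p)) has_derivative (\<lambda>p. D1 * (z0 * snd p + fst p * w0))) (at (z0, w0))"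
    using 1 has_derivative_compose[of "\<lambda>p. fst p * snd p" _ "(z0, w0)" UNIV M1.quot "(*) D1"] by simp
  then have "((\<lambda>p. inner_arg (fst p) (snd p)) has_derivative
      (\<lambda>p. z0 * (D1 * (z0 * snd p + fst p * w0)) + fst p * M1.quot (z0 * w0))) (at (z0, w0))"
    unfolding inner_arg_def by (auto intro!: derivative_eq_intros)
  then have "((\<lambda>p. f (fst p) (snd p)) has_derivative
      (\<lambda>p. D2 * (z0 * (D1 * (z0 * snd p + fst p * w0)) + fst p * M1.quot (z0 * w0)))) (at (z0, w0))"
    unfolding f_def
    using 2 has_derivative_compose[of "\<lambda>p. inner_arg (fst p) (snd p)" _ "(z0, w0)" UNIV M2.quot "(*) D2"] by simp
  then show thesis
    using that[of "D2 * (z0 * D1 * w0 + M1.quot (z0 * w0))" "D2 * z0 * D1 * z0"]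
    by (simp add: algebra_simps)
qed

section \<open>Uniqueness and existence of the fixed point of \<open>f z\<close>\<close>

lemma f_fixed_point:
  assumes "z \<in> upper_half" "w0 \<in> upper_half" "f z w0 = w0"
  shows f_norm_deriv: "cmod (deriv (f z) w0) < 1"
    and f_fixed_unique: "\<And>w. w \<in> upper_half \<Longrightarrow> f z w = w \<Longrightarrow> w = w0"
proof -
  note fu = f_upper[OF upper_halfD[OF assms(1)] _ _ disjI1[OF assms(1)]]
  have "f z holomorphic_on upper_half"
    using upper_halfD by (intro f_hol fu open_upper_half)
  moreover have "f z \<in> upper_half \<rightarrow> upper_half"
    using upper_halfD by (intro Pi_I fu)
  \<comment> \<open>Any nonzero real number could serve as the boundary point.\<close>
  moreover have "continuous_on (insert (of_real 1) upper_half) (f z)"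
    using upper_halfD assms by (intro f_cont) auto
  moreover have "f z (of_real 1) \<in> upper_half"
    by (intro fu) auto
  ultimately show "cmod (deriv (f z) w0) < 1" "\<And>w. w \<in> upper_half \<Longrightarrow> f z w = w \<Longrightarrow> w = w0"
    using upper_half_self_map_fixed_point[of "f z" w0 1] assms by blast+
qed

text \<open>The case distinctions on the size \<open>u\<close> of \<open>inner_arg z w\<close> use that
  \<open>f z w / w = \<eta>2 (inner_arg z w) / \<eta>1 (z * w)\<close>.\<close>

lemma annulus_bounds:
  assumes "r > 0" "C > 0"
  obtains \<rho> R where "0 < \<rho>" "\<rho> \<le> R"
    "\<And>s u t. \<rho> \<le> s \<Longrightarrow> s \<le> R \<Longrightarrow> u > 0 \<Longrightarrow> r * M1.H (r * s) \<le> C * u \<Longrightarrow> u \<le> C * (r * M1.H (r * s)) \<Longrightarrow>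
       M2.H u \<le> C * t \<Longrightarrow> t \<le> C * M2.H u \<Longrightarrow> \<rho> \<le> t \<and> t \<le> R"
proof -
  note pos = M1.H_pos M2.H_pos
  \<comment> \<open>Here \<open>s\<close>, \<open>u\<close>, \<open>t\<close> stand for the moduli
    of \<open>w\<close>, \<open>inner_arg z w\<close> and \<open>f z w\<close>. The two Harnack
    comparisons each cost a factor \<open>C\<close>, whence \<open>C\<^sup>2\<close>.\<close>
  obtain d where d: "d > 0" "\<And>u. 0 < u \<Longrightarrow> u \<le> d \<Longrightarrow> u * M2.H u \<le> M1.H 1 / C\<^sup>2"
    using M2.eta_neg_small[of "M1.H 1 / C\<^sup>2"] assms pos by auto
  define R0 where "R0 = max (1 / r) (C * M2.H d)"
  \<comment> \<open>If \<open>u > d\<close>, then \<open>t\<close> is bounded by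
    \<open>C * M2.H d\<close>. Otherwise \<open>t * u\<close> is small by the choice of
    \<open>d\<close>, while \<open>s * u\<close> is bounded below by monotonicity of
    \<open>r * M1.H r\<close>.\<close>
  have large: "t \<le> s"
    if s: "R0 \<le> s" and u: "u > 0" "u \<le> C * (r * M1.H (r * s))" "r * M1.H (r * s) \<le> C * u" "t \<le> C * M2.H u"
    for s u t
  proof (cases "u \<le> d")
    case False
    then have "C * M2.H u \<le> C * M2.H d" using d assms M2.H_antimono[of d u] by simp
    then show ?thesis using s u by (simp add: R0_def)
  next
    case True
    have s1: "1 \<le> r * s" "s > 0" using s assms by (auto simp: R0_def field_simps intro: less_le_trans[of 0 "1 / r"])
    have "t * (C * u) \<le> C * M2.H u * (C * u)" using u assms by (intro mult_right_mono) auto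
    also have "\<dots> = C\<^sup>2 * (u * M2.H u)" by (simp add: power2_eq_square)
    also have "\<dots> \<le> C\<^sup>2 * (M1.H 1 / C\<^sup>2)" using d(2)[OF u(1) True] by (intro mult_left_mono) auto
    also have "\<dots> = 1 * M1.H 1" using assms by simp
    also have "\<dots> \<le> r * s * M1.H (r * s)" using M1.eta_neg_mono[of 1 "r * s"] s1 by simp
    also have "\<dots> = s * (r * M1.H (r * s))" by simp
    also have "\<dots> \<le> s * (C * u)" using u s1 by (intro mult_left_mono) auto
    finally show ?thesis using u assms by (simp add: mult_le_cancel_right)
  qed
  obtain e where e: "e > 0" "\<And>v. 0 < v \<Longrightarrow> v \<le> e \<Longrightarrow> v * M1.H v \<le> M2.H 1 / C\<^sup>2"
    using M1.eta_neg_small[of "M2.H 1 / C\<^sup>2"] assms pos by auto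
  define r0 where "r0 = min (e / r) (M2.H 1 / C)"
  have r0: "r0 > 0" using e assms pos by (simp add: r0_def)
  \<comment> \<open>The mirror image of \<open>large\<close>, with the two maps exchanging roles and
    1 as the threshold for \<open>u\<close>.\<close>
  have small: "s \<le> t"
    if s: "0 < s" "s \<le> r0" and u: "u > 0" "u \<le> C * (r * M1.H (r * s))" "M2.H u \<le> C * t"
    for s u t
  proof (cases "u \<le> 1")
    case True
    then have "M2.H 1 \<le> C * t" using u M2.H_antimono[of u 1] by simp
    then have "M2.H 1 / C \<le> t" using assms by (simp add: field_simps)
    then show ?thesis using s by (simp add: r0_def)
  next
    case False
    have "s * u \<le> s * (C * (r * M1.H (r * s)))" using s u by (intro mult_left_mono) auto
    also have "\<dots> = C * (r * s * M1.H (r * s))" by simp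
    also have "\<dots> \<le> C * (M2.H 1 / C\<^sup>2)"
      using s assms by (intro mult_left_mono e) (auto simp: r0_def field_simps)
    also have "\<dots> = 1 * M2.H 1 / C" using assms by (simp add: power2_eq_square)
    also have "\<dots> \<le> u * M2.H u / C"
      using M2.eta_neg_mono[of 1 u] False assms by (intro divide_right_mono) auto
    also have "\<dots> \<le> u * (C * t) / C"
      using u assms by (intro divide_right_mono mult_left_mono) auto
    also have "\<dots> = t * u" using assms by simp
    finally show ?thesis using u by (simp add: mult_le_cancel_right)
  qed
  \<comment> \<open>\<open>M\<close> bounds \<open>t\<close> above when \<open>s \<le> R0\<close>,
    and \<open>m\<close> bounds it below when \<open>s \<ge> r0\<close>; outside these ranges
    \<open>large\<close> and \<open>small\<close> apply.\<close>
  define M where "M = C * M2.H (r * M1.H (r * R0) / C)"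
  define m where "m = M2.H (C * (r * M1.H (r * r0))) / C"
  have R0: "R0 > 0" using assms by (auto simp: R0_def intro: less_le_trans[of 0 "1 / r"])
  have m: "m > 0" using assms pos r0 by (simp add: m_def)
  have upper: "t \<le> M" if "0 < s" "s \<le> R0" "r * M1.H (r * s) \<le> C * u" "t \<le> C * M2.H u" for s u t
  proof -
    have "r * M1.H (r * R0) \<le> r * M1.H (r * s)"
      using that assms by (intro mult_left_mono M1.H_antimono) auto
    also have "\<dots> \<le> C * u" by fact
    finally have "r * M1.H (r * R0) / C \<le> u" using assms by (simp add: field_simps)
    then have "M2.H u \<le> M2.H (r * M1.H (r * R0) / C)"
      using assms pos R0 by (intro M2.H_antimono) auto
    then have "C * M2.H u \<le> M" unfolding M_def using assms by (intro mult_left_mono) auto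
    then show ?thesis using that by simp
  qed
  have lower: "m \<le> t" if "r0 \<le> s" "u > 0" "u \<le> C * (r * M1.H (r * s))" "M2.H u \<le> C * t" for s u t
  proof -
    have "u \<le> C * (r * M1.H (r * s))" by fact
    also have "\<dots> \<le> C * (r * M1.H (r * r0))"
      using that assms r0 by (intro mult_left_mono M1.H_antimono) auto
    finally have "M2.H (C * (r * M1.H (r * r0))) \<le> M2.H u"
      using that by (intro M2.H_antimono)
    then have "M2.H (C * (r * M1.H (r * r0))) \<le> C * t" using that by simp
    then show ?thesis using assms by (simp add: m_def field_simps)
  qed
  define \<rho> where "\<rho> = min r0 m"
  define R where "R = max (max R0 M) \<rho>"
  show thesis
  proof (rule that[of \<rho> R])
    show "\<rho> > 0" using r0 m by (simp add: \<rho>_def)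
    show "\<rho> \<le> R" by (simp add: R_def)
    fix s u t
    assume s: "\<rho> \<le> s" "s \<le> R" and u: "u > 0" "r * M1.H (r * s) \<le> C * u" "u \<le> C * (r * M1.H (r * s))"
      and t: "M2.H u \<le> C * t" "t \<le> C * M2.H u"
    have s0: "s > 0" using s \<open>\<rho> > 0\<close> by simp
    have "\<rho> \<le> t"
      using small[of s u t] lower[of s u t] s s0 u t by (cases "s \<le> r0") (auto simp: \<rho>_def)
    moreover have "t \<le> R"
      using large[of s u t] upper[of s u t] s s0 u t by (cases "s \<le> R0") (auto simp: R_def)
    ultimately show "\<rho> \<le> t \<and> t \<le> R" ..
  qed
qed

text \<open>In the coordinate \<open>Ln w\<close>, the map \<open>f z\<close> preserves the rectangle of all \<open>w\<close> with
  \<open>\<rho> \<le> \<bar>w\<bar> \<le> R\<close> and \<open>0 \<le> arg w \<le> \<pi> - arg z\<close>.\<close>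

lemma f_fixed_exists:
  assumes z: "z \<in> upper_half"
  shows "\<exists>w\<in>upper_half. f z w = w"
proof -
  obtain r a where ra: "z = rcis r a" "r > 0" "0 < a" "a < pi" using z by (rule upper_half_polar)
  \<comment> \<open>Harnack is applied with \<open>a\<close> because both quotients are evaluated at
    angles in \<open>[a, pi]\<close>: \<open>z * w\<close> has angle \<open>a + b\<close>, and
    \<open>inner_arg z w\<close> has angle \<open>c \<ge> a\<close>.\<close>
  obtain C1 where C1: "C1 > 0"
    "\<And>r b. 0 < r \<Longrightarrow> a \<le> b \<Longrightarrow> b \<le> pi \<Longrightarrow> M1.H r \<le> C1 * cmod (M1.quot (rcis r b))"
    "\<And>r b. 0 < r \<Longrightarrow> a \<le> b \<Longrightarrow> b \<le> pi \<Longrightarrow> cmod (M1.quot (rcis r b)) \<le> C1 * M1.H r"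
    using M1.harnack[of a] ra by auto
  obtain C2 where C2: "C2 > 0"
    "\<And>r b. 0 < r \<Longrightarrow> a \<le> b \<Longrightarrow> b \<le> pi \<Longrightarrow> M2.H r \<le> C2 * cmod (M2.quot (rcis r b))"
    "\<And>r b. 0 < r \<Longrightarrow> a \<le> b \<Longrightarrow> b \<le> pi \<Longrightarrow> cmod (M2.quot (rcis r b)) \<le> C2 * M2.H r"
    using M2.harnack[of a] ra by auto
  define C where "C = max C1 C2"
  have C: "C > 0" "C1 \<le> C" "C2 \<le> C" using C1 by (auto simp: C_def)
  obtain \<rho> R where \<rho>: "0 < \<rho>" "\<rho> \<le> R" and step:
    "\<And>s u t. \<rho> \<le> s \<Longrightarrow> s \<le> R \<Longrightarrow> u > 0 \<Longrightarrow> r * M1.H (r * s) \<le> C * u \<Longrightarrow> u \<le> C * (r * M1.H (r * s)) \<Longrightarrow>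
       M2.H u \<le> C * t \<Longrightarrow> t \<le> C * M2.H u \<Longrightarrow> \<rho> \<le> t \<and> t \<le> R"
    by (rule annulus_bounds[OF ra(2) C(1)]) (rule that)
  define K where "K = cbox (Complex (ln \<rho>) 0) (Complex (ln R) (pi - a))"
  have inK: "x \<in> K \<longleftrightarrow> ln \<rho> \<le> Re x \<and> Re x \<le> ln R \<and> 0 \<le> Im x \<and> Im x \<le> pi - a" for x
    by (auto simp: K_def in_cbox_complex_iff)
  have exp_rcis: "exp x = rcis (exp (Re x)) (Im x)" for x
    by (simp add: complex_eq_iff Re_exp Im_exp)
  have exp_up: "Im (exp x) \<ge> 0 \<and> exp x \<noteq> 0" if "x \<in> K" for x
    using that ra by (auto simp: inK Im_exp intro!: mult_nonneg_nonneg sin_ge_zero)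
  have f_up: "f z (exp x) \<in> upper_half" if "x \<in> K" for x
    using f_upper(3)[OF upper_halfD[OF z] _ _ disjI1[OF z]] exp_up[OF that] by blast
  define T where "T x = Ln (f z (exp x))" for x
  have "continuous_on (exp ` K) (f z)"
    using exp_up by (intro f_cont z) auto
  then have "continuous_on K (\<lambda>x. f z (exp x))"
    by (rule continuous_on_compose2) (auto intro: continuous_intros)
  then have T_cont: "continuous_on K T"
    unfolding T_def using f_up
    by (intro continuous_on_compose2[OF continuous_on_Ln[of upper_half]])
      (auto simp: upper_half_def complex_nonpos_Reals_iff)
  have T_maps: "T x \<in> K" if "x \<in> K" for x
  proof -
    define s where "s = exp (Re x)"
    define b where "b = Im x"
    have s: "\<rho> \<le> s" "s \<le> R" "s > 0"
    proof -
      have "exp (ln \<rho>) \<le> exp (Re x)" "exp (Re x) \<le> exp (ln R)"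
        using that by (simp_all only: inK exp_le_cancel_iff)
      then show "\<rho> \<le> s" "s \<le> R" "s > 0" using \<rho> by (simp_all add: s_def)
    qed
    have b: "0 \<le> b" "b \<le> pi - a" using that by (auto simp: inK b_def)
    have w: "exp x = rcis s b" by (simp add: exp_rcis s_def b_def)
    have ab: "0 \<le> a" "a \<le> pi" "b \<le> pi" "0 < a \<and> a < pi \<or> 0 < b \<and> b < pi"
      using ra b by auto
    obtain p c q d where "z * exp x \<in> slit_plane"
      and *: "p > 0" "0 < c" "c < pi" "min a (pi - b) \<le> c" "inner_arg z (exp x) = rcis p c"
      "q > 0" "0 < d" "d \<le> pi - c" "f z (exp x) = rcis q d"
      by (rule f_polar[OF ra(2) s(3) ab(1,2) b(1) ab(3,4), folded ra(1) w]) (rule that)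
    have c: "a \<le> c" using * b by simp
    let ?v = "cmod (M1.quot (rcis (r * s) (a + b)))"
    have p: "p = r * ?v"
    proof -
      have "cmod (inner_arg z (exp x)) = r * ?v"
        using ra by (simp add: inner_arg_def w norm_mult rcis_mult)
      then show ?thesis using * by simp
    qed
    have q: "q = cmod (M2.quot (rcis p c))" using * by (metis f_def complex_mod_rcis abs_of_pos)
    have pos: "M1.H (r * s) > 0" "M2.H p > 0" using M1.H_pos M2.H_pos ra s * by auto
    have v: "M1.H (r * s) \<le> C * ?v" "?v \<le> C * M1.H (r * s)"
    proof -
      have "M1.H (r * s) \<le> C1 * ?v" "?v \<le> C1 * M1.H (r * s)"
        using ra s b by (auto intro!: C1(2,3))
      moreover have "C1 * ?v \<le> C * ?v" "C1 * M1.H (r * s) \<le> C * M1.H (r * s)"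
        using C(2) pos(1) by (auto intro!: mult_right_mono)
      ultimately show "M1.H (r * s) \<le> C * ?v" "?v \<le> C * M1.H (r * s)" by linarith+
    qed
    have q': "M2.H p \<le> C * q" "q \<le> C * M2.H p"
    proof -
      have "M2.H p \<le> C2 * q" "q \<le> C2 * M2.H p"
        unfolding q using *(1,3) c by (auto intro!: C2(2,3))
      moreover have "C2 * q \<le> C * q" "C2 * M2.H p \<le> C * M2.H p"
        using C(3) pos(2) *(6) by (auto intro!: mult_right_mono)
      ultimately show "M2.H p \<le> C * q" "q \<le> C * M2.H p" by linarith+
    qed
    have "r * M1.H (r * s) \<le> C * p" "p \<le> C * (r * M1.H (r * s))"
      using v ra mult_left_mono[OF v(1), of r] mult_left_mono[OF v(2), of r] by (auto simp: p algebra_simps)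
    then have "\<rho> \<le> q \<and> q \<le> R" using step[of s p q] s q' * by blast
    moreover have "Re (T x) = ln q" "Im (T x) = d"
    proof -
      have "exp (Complex (ln q) d) = rcis q d"
        using *(6) by (simp add: exp_rcis)
      then have "T x = Ln (exp (Complex (ln q) d))"
        by (simp only: T_def *(9))
      \<comment> \<open>\<open>Ln\<close> inverts \<open>exp\<close> here because \<open>d\<close>
        lies between 0 and \<open>pi\<close>.\<close>
      also have "\<dots> = Complex (ln q) d" using * c ra by (intro Ln_exp) auto
      finally show "Re (T x) = ln q" "Im (T x) = d" by auto
    qed
    ultimately show ?thesis
      using * c \<rho> by (auto simp: inK)
  qed
  have "K \<noteq> {}" using inK[of "Complex (ln \<rho>) 0"] \<rho> ra by auto
  moreover have "compact K" "convex K" by (auto simp: K_def compact_cbox convex_box)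
  ultimately obtain x where x: "x \<in> K" "T x = x"
    using brouwer[of K T] T_cont T_maps by blast
  \<comment> \<open>\<open>K\<close> allows the angle 0, but the fixed point is a value of
    \<open>f z\<close> and therefore interior.\<close>
  have "f z (exp x) \<noteq> 0" using f_up[OF x(1)] by (auto simp: upper_half_def)
  then have "f z (exp x) = exp x" using x(2) by (metis T_def exp_Ln)
  then show ?thesis using f_up[OF x(1)] by metis
qed

section \<open>Analytic dependence of the fixed point on \<open>z\<close>\<close>

lemma fixed_point_function:
  "\<exists>!h. h \<in> upper_half \<rightarrow>\<^sub>E upper_half \<and> h analytic_on upper_half \<and> (\<forall>z\<in>upper_half. f z (h z) = h z)"
proof -
  \<comment> \<open>The restriction fixes the values off the upper half-plane, so that uniqueness is
    an equality of total functions.\<close>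
  define h where "h = restrict (\<lambda>z. SOME w. w \<in> upper_half \<and> f z w = w) upper_half"
  have h: "h z \<in> upper_half" "f z (h z) = h z" if "z \<in> upper_half" for z
    using someI_ex[of "\<lambda>w. w \<in> upper_half \<and> f z w = w"] f_fixed_exists[OF that] that
    by (auto simp: h_def)
  have "h field_differentiable at z0" if z0: "z0 \<in> upper_half" for z0
  proof -
    obtain A B where AB: "((\<lambda>p. f (fst p) (snd p)) has_derivative (\<lambda>p. A * fst p + B * snd p)) (at (z0, h z0))"
      using f_total_derivative[OF z0 h(1)[OF z0]] .
    \<comment> \<open>Restricting the total derivative to the slice at \<open>z0\<close> identifies
      \<open>B\<close> with the derivative of \<open>f z0\<close> at its fixed point.\<close>
    have "((\<lambda>w. (z0, w)) has_derivative (\<lambda>w. (0, w))) (at (h z0))"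
      by (auto intro!: derivative_eq_intros)
    then have "(f z0 has_derivative (*) B) (at (h z0))"
      using has_derivative_compose[of "\<lambda>w. (z0, w)" _ "h z0" UNIV "\<lambda>p. f (fst p) (snd p)"] AB
      by fastforce
    then have "deriv (f z0) (h z0) = B"
      by (simp add: has_field_derivative_def DERIV_imp_deriv)
    then have B: "cmod B < 1" using f_norm_deriv[OF z0 h[OF z0]] by simp
    have "(h has_field_derivative A / (1 - B)) (at z0)"
    proof (rule implicit_fixed_point_derivative[OF AB B])
      show "continuous_on upper_half (\<lambda>w. f (fst (z, w)) (snd (z, w)))" if "z \<in> upper_half" for z
        using f_cont[OF that, of upper_half] upper_halfD by auto
      show "w = h z" if "z \<in> upper_half" "w \<in> upper_half" "f (fst (z, w)) (snd (z, w)) = w" for z w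
        using f_fixed_unique[OF that(1) h[OF that(1)]] that by simp
    qed (use h z0 open_upper_half in auto)
    then show ?thesis by (auto simp: field_differentiable_def)
  qed
  then have "h analytic_on upper_half"
    by (simp add: analytic_on_open open_upper_half holomorphic_on_def field_differentiable_at_within)
  moreover have "h \<in> upper_half \<rightarrow>\<^sub>E upper_half"
    using h by (auto simp: h_def)
  ultimately show ?thesis
  proof (intro ex1I[of _ h] conjI ballI h(2))
    fix g assume g: "g \<in> upper_half \<rightarrow>\<^sub>E upper_half \<and> g analytic_on upper_half \<and> (\<forall>z\<in>upper_half. f z (g z) = g z)"
    show "g = h"
    proof (rule PiE_ext[of _ upper_half "\<lambda>_. upper_half"])
      show "g z = h z" if "z \<in> upper_half" for z
        using f_fixed_unique[OF that h[OF that], of "g z"] g that by auto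
    qed (use g \<open>h \<in> upper_half \<rightarrow>\<^sub>E upper_half\<close> in auto)
  qed auto
qed

end

theorem theorem1p27:
  fixes eta :: "nat \<Rightarrow> complex \<Rightarrow> complex"
  assumes maps: "\<And>j. j \<in> {1, 2} \<Longrightarrow> eta j \<in> slit_plane \<rightarrow> slit_plane"
    and analytic: "\<And>j. j \<in> {1, 2} \<Longrightarrow> eta j analytic_on slit_plane"
    and lim: "\<And>j. j \<in> {1, 2} \<Longrightarrow> ((\<lambda>x::real. eta j (complex_of_real x)) \<longlongrightarrow> 0) (at_left 0)"
    and arg: "\<And>j z. j \<in> {1, 2} \<Longrightarrow> z \<in> upper_half \<Longrightarrow>
                pi > Arg2pi (eta j z) \<and> Arg2pi (eta j z) > Arg2pi z"
    and sym: "\<And>j z. j \<in> {1, 2} \<Longrightarrow> z \<in> slit_plane \<Longrightarrow> eta j (cnj z) = cnj (eta j z)"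
  shows "(\<forall>(z, w)\<in>sub_domain. sub_fun_defined_at eta z w \<and> sub_fun eta z w \<in> upper_half) \<and>
         (\<exists>!h. h \<in> upper_half \<rightarrow>\<^sub>E upper_half \<and> h analytic_on upper_half \<and>
               (\<forall>z\<in>upper_half. sub_fun eta z (h z) = h z))"
proof -
  have M: "slit_map (eta j)" if "j \<in> {1, 2}" for j
    using maps[OF that] analytic_imp_holomorphic[OF analytic[OF that]] lim[OF that] arg[OF that] sym[OF that]
    by unfold_locales auto
  interpret slit_map_pair "eta 1" "eta 2"
    unfolding slit_map_pair_def using M by auto
  have quot: "M1.quot = eta_quot eta 1" "M2.quot = eta_quot eta 2"
    by (intro ext, simp only: M1.quot_def M2.quot_def eta_quot_def)+
  have f: "f = sub_fun eta"
    by (intro ext) (simp only: f_def inner_arg_def sub_fun_def quot)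
  have "sub_fun_defined_at eta z w \<and> sub_fun eta z w \<in> upper_half" if "(z, w) \<in> sub_domain" for z w
  proof -
    have "Im z \<ge> 0" "z \<noteq> 0" "Im w \<ge> 0" "w \<noteq> 0" "w \<in> upper_half"
      using that by (auto simp: sub_domain_def upper_half_def complex_is_Real_iff)
    then show ?thesis
      using f_upper[of z w] inner_slit[of z w]
      by (simp only: sub_fun_defined_at_def f[symmetric] quot[symmetric] inner_arg_def) blast
  qed
  then show ?thesis
    using fixed_point_function unfolding f by blast
qed

end
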